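(* Let $i$ and $s$ be IR-MIA over the same input set $I$ and output set $O$, where $i$ is weak must-input-enabled and $s$ satisfies that every state $q$ with $q\xrightarrow{\tau}_\Diamond$ also satisfies $q\xrightarrow{\tau}_\Box$ (so that the demonic completion $\Xi(s)$ is defined). If $i\ \textbf{modal-irioco}\ s$, then $i\ \textbf{modal-irioco}\ \Xi(s)$.
   Context: An IR-MIA is a tuple $(Q,I,O,\longrightarrow_\Box,\longrightarrow_\Diamond,q_\Phi)$ with a designated initial state (the IR-MIA is identified with its initial state), where $Q$ is a finite set of states containing a failure state $q_\Phi$, $I,O$ are disjoint finite sets of inputs/outputs, $\tau\notin I\cup O$ is internal, and the must-relation $\longrightarrow_\Box$ and may-relation $\longrightarrow_\Diamond$ are subsets of $((Q\setminus\{q_\Phi\})\times I\times Q)\cup((Q\setminus\{q_\Phi\})\times(O\cup\{\tau\})\times(Q\setminus\{q_\Phi\}))$ with: $q\xrightarrow{a}_\Box q'$ implies $q\xrightarrow{a}_\Diamond q'$; for $i\in I$, $q\xrightarrow{i}_\Diamond q_\Phi$ iff $q\xrightarrow{i}_\Box q_\Phi$; and if $q\xrightarrow{i}_\Box q_\Phi$ then every $i$-may-successor of $q$ is $q_\Phi$. For $\gamma\in\{\Box,\Diamond\}$: $q\xrightarrow{a}_\gamma$ means some $a$-successor exists, $q\not\xrightarrow{a}_\gamma$ otherwise; $q\overset{\epsilon}{\Longrightarrow}_\gamma q'$ means $q=q'$ or $q'$ is reached by finitely many $\tau$-steps of $\longrightarrow_\gamma$; $q\overset{a}{\Longrightarrow}_\gamma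 q'$ means $q\overset{\epsilon}{\Longrightarrow}_\gamma\xrightarrow{a}_\gamma\overset{\epsilon}{\Longrightarrow}_\gamma q'$, extended to sequences. Observations: $\mathrm{init}_\gamma(p)=\{\mu\in I\cup O\mid p\overset{\mu}{\Longrightarrow}_\gamma\}\cup\{\varphi\mid p=p_\Phi\}$; $\delta_\Diamond(p)$ iff $\mathrm{init}_\Box(p)\subseteq I$ and $p\neq p_\Phi$; $\delta_\Box(p)$ iff $\mathrm{init}_\Diamond(p)\subseteq I$ and $p\ne p_\Phi$; $\varphi_\Diamond(p)$ iff $p=p_\Phi$ or there exist $p''$, $i\in I$ with $p''\xrightarrow{i}_\Diamond p$ and not $p''\xrightarrow{i}_\Box p$; $\varphi_\Box(p)$ iff $p=p_\Phi$. Add self-loops $p\xrightarrow{\delta}_\gamma p$ iff $\delta_\gamma(p)$, $p\xrightarrow{\varphi}_\gamma p$ iff $\varphi_\gamma(p)$. For $\sigma\in(I\cup O\cup\{\delta,\varphi\})^*$: $p\ \mathrm{after}_\gamma\ \sigma=\{p'\mid p\overset{\sigma}{\Longrightarrow}_\gamma p'\}$, $\mathrm{Straces}_\gamma(p)=\{\sigma\mid p\overset{\sigma}{\Longrightarrow}_\gamma\}$, $\mathrm{Out}_\gamma(p)=\{\mu\in O\mid p\xrightarrow{\mu}_\gamma\}\cup\{\delta\mid\delta_\gamma(p)\}\cup\{\varphi\mid\varphi_\gamma(p)\}$, $\mathrm{Out}_\gamma(S)=\bigcup_{p\in S}\mathrm{Out}_\gamma(p)$. An IR-MIA is weak $\gamma$-input-enabled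 ("may" for $\Diamond$, "must" for $\Box$) if for every state $q\neq q_\Phi$ and $i\in I$ there is $q'$ with $q\overset{i}{\Longrightarrow}_\gamma q'$. For $i,s$ over the same $I,O$ with $i$ weak may-input-enabled: $i\ \textbf{modal-irioco}\ s$ iff (1) for all $\sigma\in\mathrm{Straces}_\Diamond(s)$, $\mathrm{Out}_\Diamond(i\ \mathrm{after}_\Diamond\ \sigma)\subseteq\mathrm{Out}_\Diamond(s\ \mathrm{after}_\Diamond\ \sigma)$, and (2) for all $\sigma\in\mathrm{Straces}_\Diamond(i)$, $\mathrm{Out}_\Box(s\ \mathrm{after}_\Diamond\ \sigma)\subseteq\mathrm{Out}_\Box(i\ \mathrm{after}_\Diamond\ \sigma)$. Demonic completion: for an IR-MIA $s=(Q,I,O,\longrightarrow_\Box,\longrightarrow_\Diamond,q_\Phi)$ in which $q\xrightarrow{\tau}_\Diamond$ implies $q\xrightarrow{\tau}_\Box$ for all $q$, $\Xi(s)=(Q\cup\{q_\chi,q_\Omega\},I,O,\longrightarrow'_\Box,\longrightarrow'_\Diamond,q_\Phi)$ with the same initial state, where $q_\chi,q_\Omega\notin Q$ are fresh, and, with $N=\{(q,i,q_\chi)\mid q\in Q\setminus\{q_\Phi\}, i\in I, q\not\xrightarrow{i}_\Box, q\not\xrightarrow{\tau}_\Box\}$: $\longrightarrow'_\Box=\longrightarrow_\Box\cup N\cup\{(q_\chi,\tau,q_\Omega)\}\cup\{(q_\chi,\lambda,q_\chi),(q_\Omega,\lambda,q_\Omega)\mid\lambda\in I\}$ and $\longrightarrow'_\Diamond=\longrightarrow_\Diamond\cup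 N\cup\{(q_\chi,\tau,q_\Omega)\}\cup\{(q_\Omega,\lambda,q_\chi)\mid\lambda\in I\cup O\}\cup\{(q_\chi,\lambda,q_\chi),(q_\Omega,\lambda,q_\Omega)\mid\lambda\in I\}$.
   Formalization: The output set O is additionally assumed nonempty: for O empty the claim fails, e.g. I={a}, i with the single transition to its failure state on a, and s with no transitions, since then the added state of Ξ(s) is must-quiescent while i after a only shows failure. *)

theory Defs
  imports Main
begin

datatype modality = Must | May

fun dual :: "modality \<Rightarrow> modality" where
  "dual Must = May"
| "dual May = Must"

datatype 'a label = Act 'a | Tau

datatype 'a obs = Vis 'a | Delta | Phi

record ('q, 'a) irmia =
  states :: "'q set"
  inputs :: "'a set"
  outputs :: "'a set"
  must :: "('q \<times> 'a label \<times> 'q) set"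
  may :: "('q \<times> 'a label \<times> 'q) set"
  fail_state :: "'q"
  initial :: "'q"

definition transitions_ok ::
  "('q, 'a) irmia \<Rightarrow> ('q \<times> 'a label \<times> 'q) set \<Rightarrow> bool" where
  "transitions_ok M R \<longleftrightarrow>
     R \<subseteq> ((states M - {fail_state M}) \<times> (Act ` inputs M) \<times> states M)
       \<union> ((states M - {fail_state M}) \<times> (Act ` outputs M \<union> {Tau}) \<times> (states M - {fail_state M}))"

definition is_irmia :: "('q, 'a) irmia \<Rightarrow> bool" where
  "is_irmia M \<longleftrightarrow>
     finite (states M) \<and> fail_state M \<in> states M \<and> initial M \<in> states M \<and>
     finite (inputs M) \<and> finite (outputs M) \<and> inputs M \<inter> outputs M = {} \<and>
     transitions_ok M (must M) \<and> transitions_ok M (may M) \<and>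
     (\<forall>q l q'. (q, l, q') \<in> must M \<longrightarrow> (q, l, q') \<in> may M) \<and>
     (\<forall>q. \<forall>a\<in>inputs M.
        (q, Act a, fail_state M) \<in> may M \<longleftrightarrow> (q, Act a, fail_state M) \<in> must M) \<and>
     (\<forall>q. \<forall>a\<in>inputs M. (q, Act a, fail_state M) \<in> must M \<longrightarrow>
        (\<forall>q'. (q, Act a, q') \<in> may M \<longrightarrow> q' = fail_state M))"

fun trans_rel :: "('q, 'a) irmia \<Rightarrow> modality \<Rightarrow> ('q \<times> 'a label \<times> 'q) set" where
  "trans_rel M Must = must M"
| "trans_rel M May = may M"

definition enabled :: "('q, 'a) irmia \<Rightarrow> modality \<Rightarrow> 'q \<Rightarrow> 'a label \<Rightarrow> bool" where
  "enabled M \<gamma> q l \<longleftrightarrow> (\<exists>q'. (q, l, q') \<in> trans_rel M \<gamma>)"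

definition eps :: "('q, 'a) irmia \<Rightarrow> modality \<Rightarrow> 'q \<Rightarrow> 'q \<Rightarrow> bool" where
  "eps M \<gamma> = (\<lambda>q q'. (q, Tau, q') \<in> trans_rel M \<gamma>)\<^sup>*\<^sup>*"

definition weak_act :: "('q, 'a) irmia \<Rightarrow> modality \<Rightarrow> 'q \<Rightarrow> 'a \<Rightarrow> 'q \<Rightarrow> bool" where
  "weak_act M \<gamma> q a q' \<longleftrightarrow>
     (\<exists>r r'. eps M \<gamma> q r \<and> (r, Act a, r') \<in> trans_rel M \<gamma> \<and> eps M \<gamma> r' q')"

definition init_obs :: "('q, 'a) irmia \<Rightarrow> modality \<Rightarrow> 'q \<Rightarrow> 'a obs set" where
  "init_obs M \<gamma> p =
     {Vis a | a. a \<in> inputs M \<union> outputs M \<and> (\<exists>p'. weak_act M \<gamma> p a p')}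
     \<union> (if p = fail_state M then {Phi} else {})"

text \<open>May-quiescence refers to the must-transitions, and vice versa.\<close>

definition quiescent :: "('q, 'a) irmia \<Rightarrow> modality \<Rightarrow> 'q \<Rightarrow> bool" where
  "quiescent M \<gamma> p \<longleftrightarrow> init_obs M (dual \<gamma>) p \<subseteq> Vis ` inputs M \<and> p \<noteq> fail_state M"

fun failing :: "('q, 'a) irmia \<Rightarrow> modality \<Rightarrow> 'q \<Rightarrow> bool" where
  "failing M May p \<longleftrightarrow> p = fail_state M \<or>
     (\<exists>p''. \<exists>a\<in>inputs M. (p'', Act a, p) \<in> may M \<and> (p'', Act a, p) \<notin> must M)"
| "failing M Must p \<longleftrightarrow> p = fail_state M"

fun obs_step :: "('q, 'a) irmia \<Rightarrow> modality \<Rightarrow> 'q \<Rightarrow> 'a obs \<Rightarrow> 'q \<Rightarrow> bool" where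
  "obs_step M \<gamma> p (Vis a) p' \<longleftrightarrow> (p, Act a, p') \<in> trans_rel M \<gamma>"
| "obs_step M \<gamma> p Delta p' \<longleftrightarrow> p' = p \<and> quiescent M \<gamma> p"
| "obs_step M \<gamma> p Phi p' \<longleftrightarrow> p' = p \<and> failing M \<gamma> p"

definition weak_obs :: "('q, 'a) irmia \<Rightarrow> modality \<Rightarrow> 'q \<Rightarrow> 'a obs \<Rightarrow> 'q \<Rightarrow> bool" where
  "weak_obs M \<gamma> p x p' \<longleftrightarrow>
     (\<exists>q q'. eps M \<gamma> p q \<and> obs_step M \<gamma> q x q' \<and> eps M \<gamma> q' p')"

fun weak_trace :: "('q, 'a) irmia \<Rightarrow> modality \<Rightarrow> 'q \<Rightarrow> 'a obs list \<Rightarrow> 'q \<Rightarrow> bool" where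
  "weak_trace M \<gamma> p [] p' \<longleftrightarrow> eps M \<gamma> p p'"
| "weak_trace M \<gamma> p (x # \<sigma>) p' \<longleftrightarrow> (\<exists>q. weak_obs M \<gamma> p x q \<and> weak_trace M \<gamma> q \<sigma> p')"

definition observations :: "('q, 'a) irmia \<Rightarrow> 'a obs set" where
  "observations M = Vis ` (inputs M \<union> outputs M) \<union> {Delta, Phi}"

definition after :: "('q, 'a) irmia \<Rightarrow> modality \<Rightarrow> 'a obs list \<Rightarrow> 'q set" where
  "after M \<gamma> \<sigma> = {p'. weak_trace M \<gamma> (initial M) \<sigma> p'}"

definition Straces :: "('q, 'a) irmia \<Rightarrow> modality \<Rightarrow> 'a obs list set" where
  "Straces M \<gamma> = {\<sigma> \<in> lists (observations M). \<exists>p'. weak_trace M \<gamma> (initial M) \<sigma> p'}"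

definition Out :: "('q, 'a) irmia \<Rightarrow> modality \<Rightarrow> 'q \<Rightarrow> 'a obs set" where
  "Out M \<gamma> p =
     {Vis a | a. a \<in> outputs M \<and> enabled M \<gamma> p (Act a)}
     \<union> (if quiescent M \<gamma> p then {Delta} else {})
     \<union> (if failing M \<gamma> p then {Phi} else {})"

definition Out_set :: "('q, 'a) irmia \<Rightarrow> modality \<Rightarrow> 'q set \<Rightarrow> 'a obs set" where
  "Out_set M \<gamma> S = (\<Union>p\<in>S. Out M \<gamma> p)"

definition weak_input_enabled :: "('q, 'a) irmia \<Rightarrow> modality \<Rightarrow> bool" where
  "weak_input_enabled M \<gamma> \<longleftrightarrow>
     (\<forall>q\<in>states M - {fail_state M}. \<forall>a\<in>inputs M. \<exists>q'. weak_act M \<gamma> q a q')"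

definition modal_irioco :: "('p, 'a) irmia \<Rightarrow> ('q, 'a) irmia \<Rightarrow> bool" where
  "modal_irioco i s \<longleftrightarrow>
     inputs i = inputs s \<and> outputs i = outputs s \<and> weak_input_enabled i May \<and>
     (\<forall>\<sigma>\<in>Straces s May. Out_set i May (after i May \<sigma>) \<subseteq> Out_set s May (after s May \<sigma>)) \<and>
     (\<forall>\<sigma>\<in>Straces i May. Out_set s Must (after s May \<sigma>) \<subseteq> Out_set i Must (after i May \<sigma>))"

text \<open>The parameters \<open>q\<^sub>\<chi>\<close> and \<open>q\<^sub>\<Omega>\<close> are meant to be distinct and
  not in \<open>states s\<close>. If \<open>outputs s = {}\<close>, then \<open>q\<^sub>\<chi>\<close> and \<open>q\<^sub>\<Omega>\<close> are must-quiescent,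
  and the completion need not preserve \<open>modal_irioco\<close>.\<close>

definition underspecified ::
  "('q, 'a) irmia \<Rightarrow> 'q \<Rightarrow> ('q \<times> 'a label \<times> 'q) set" where
  "underspecified s q\<^sub>\<chi> =
     {(q, Act a, q\<^sub>\<chi>) | q a. q \<in> states s - {fail_state s} \<and> a \<in> inputs s \<and>
        \<not> enabled s Must q (Act a) \<and> \<not> enabled s Must q Tau}"

definition demonic_completion ::
  "('q, 'a) irmia \<Rightarrow> 'q \<Rightarrow> 'q \<Rightarrow> ('q, 'a) irmia" where
  "demonic_completion s q\<^sub>\<chi> q\<^sub>\<Omega> =
     \<lparr> states = states s \<union> {q\<^sub>\<chi>, q\<^sub>\<Omega>},
       inputs = inputs s,
       outputs = outputs s,
       must = must s \<union> underspecified s q\<^sub>\<chi> \<union> {(q\<^sub>\<chi>, Tau, q\<^sub>\<Omega>)}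
         \<union> {(q\<^sub>\<chi>, Act a, q\<^sub>\<chi>) | a. a \<in> inputs s}
         \<union> {(q\<^sub>\<Omega>, Act a, q\<^sub>\<Omega>) | a. a \<in> inputs s},
       may = may s \<union> underspecified s q\<^sub>\<chi> \<union> {(q\<^sub>\<chi>, Tau, q\<^sub>\<Omega>)}
         \<union> {(q\<^sub>\<Omega>, Act a, q\<^sub>\<chi>) | a. a \<in> inputs s \<union> outputs s}
         \<union> {(q\<^sub>\<chi>, Act a, q\<^sub>\<chi>) | a. a \<in> inputs s}
         \<union> {(q\<^sub>\<Omega>, Act a, q\<^sub>\<Omega>) | a. a \<in> inputs s},
       fail_state = fail_state s,
       initial = initial s \<rparr>"

end

theory Submission
  imports Defs
begin

text \<open>The completion leaves everything that happens inside \<open>states s\<close> unchanged: the only way out is an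
  underspecified input leading to \<open>q\<^sub>\<chi>\<close>, and there is no way back. From \<open>q\<^sub>\<chi>\<close> every suspension trace
  can be performed returning to \<open>q\<^sub>\<chi>\<close>, so as soon as a trace leaves \<open>states s\<close> it may reach both
  \<open>q\<^sub>\<chi>\<close> and \<open>q\<^sub>\<Omega>\<close>, which together allow every output, quiescence and failure; the may-condition
  is then trivial. The must-condition survives because the new states have no must-observations,
  where the absence of must-quiescence relies on \<open>outputs s \<noteq> {}\<close>.\<close>

section \<open>Weak transitions and observations of an arbitrary IR-MIA\<close>

lemma eps_refl: "eps M \<gamma> q q"
  by (simp add: eps_def)

lemma eps_trans: "eps M \<gamma> p q \<Longrightarrow> eps M \<gamma> q r \<Longrightarrow> eps M \<gamma> p r"
  by (simp add: eps_def)

lemma eps_step: "(p, Tau, q) \<in> trans_rel M \<gamma> \<Longrightarrow> eps M \<gamma> p q"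
  by (auto simp: eps_def)

lemma weak_trace_eps:
  "weak_trace M \<gamma> p \<sigma> q \<Longrightarrow> eps M \<gamma> q r \<Longrightarrow> weak_trace M \<gamma> p \<sigma> r"
  by (induction \<sigma> arbitrary: p) (auto intro: eps_trans)

lemma Out_subset: "Out M \<gamma> p \<subseteq> Vis ` outputs M \<union> {Delta, Phi}"
  by (auto simp: Out_def)

lemma trans_rel_states:
  assumes "is_irmia M" "(q, l, q') \<in> trans_rel M \<gamma>"
  shows "q \<in> states M" "q' \<in> states M"
  using assms by (cases \<gamma>; auto simp: is_irmia_def transitions_ok_def)+

text \<open>\<open>Delta\<close> and \<open>Phi\<close> are self-loops, so only genuine transitions
  can leave \<open>S\<close>. The set is kept arbitrary because the invariant is used for
  \<open>s\<close> with its own states and for the completion with the two extra ones.\<close>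

lemma weak_trace_target:
  assumes closed: "\<And>p l p'. (p, l, p') \<in> trans_rel M \<gamma> \<Longrightarrow> p' \<in> S"
    and "weak_trace M \<gamma> q \<sigma> q'" "q \<in> S"
  shows "q' \<in> S"
proof -
  have eps: "p' \<in> S" if "eps M \<gamma> p p'" "p \<in> S" for p p'
    using that unfolding eps_def by (induction rule: rtranclp_induct) (auto dest: closed)
  have obs: "p' \<in> S" if "obs_step M \<gamma> p x p'" "p \<in> S" for p x p'
    using that by (cases x) (auto dest: closed)
  show ?thesis
    using assms(2,3)
  proof (induction \<sigma> arbitrary: q)
    case Nil
    then show ?case using eps by simp
  next
    case (Cons x \<sigma>)
    then show ?case
      unfolding weak_trace.simps weak_obs_def by (meson eps obs)
  qed
qed

text \<open>\<open>Phi\<close> is an initial observation only of the failure state, and by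
  disjointness a visible action outside the inputs is an output.\<close>

lemma quiescent_iff:
  assumes "inputs M \<inter> outputs M = {}"
  shows "quiescent M \<gamma> p \<longleftrightarrow>
    p \<noteq> fail_state M \<and> (\<forall>a\<in>outputs M. \<forall>p'. \<not> weak_act M (dual \<gamma>) p a p')"
  using assms by (auto simp: quiescent_def init_obs_def)

text \<open>Here \<open>c\<close> stands for \<open>q\<^sub>\<chi>\<close> and \<open>w\<close> for
  \<open>q\<^sub>\<Omega>\<close>.\<close>

locale completion =
  fixes s :: "('q, 'a) irmia" and c w :: 'q
  assumes irmia: "is_irmia s"
    and c_fresh: "c \<notin> states s" and w_fresh: "w \<notin> states s" and c_neq_w: "c \<noteq> w"
begin

abbreviation D :: "('q, 'a) irmia" where "D \<equiv> demonic_completion s c w"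

section \<open>The original states inside the completion\<close>

lemma D_simps [simp]:
  "inputs D = inputs s" "outputs D = outputs s" "fail_state D = fail_state s"
  "initial D = initial s" "states D = states s \<union> {c, w}"
  by (simp_all add: demonic_completion_def)

lemma observations_D [simp]: "observations D = observations s"
  by (simp add: observations_def)

lemma disjoint: "inputs s \<inter> outputs s = {}"
  and fail_state_in: "fail_state s \<in> states s"
  and initial_in: "initial s \<in> states s"
  using irmia by (simp_all add: is_irmia_def)

text \<open>Every added transition ends in \<open>c\<close> or \<open>w\<close>.\<close>

lemma trans_into:
  "q' \<in> states s \<Longrightarrow> (q, l, q') \<in> trans_rel D \<gamma> \<longleftrightarrow> (q, l, q') \<in> trans_rel s \<gamma>"
  using c_fresh w_fresh
  by (cases \<gamma>) (auto simp: demonic_completion_def underspecified_def)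

lemma trans_from:
  "q \<in> states s \<Longrightarrow> (q, l, q') \<in> trans_rel D \<gamma> \<longleftrightarrow>
     (q, l, q') \<in> trans_rel s \<gamma> \<or> (q, l, q') \<in> underspecified s c"
  using c_fresh w_fresh
  by (cases \<gamma>) (auto simp: demonic_completion_def)

text \<open>Read backwards from \<open>q'\<close>, each step ends in an original state, so it is a
  transition of \<open>s\<close> and starts in an original state again.\<close>

lemma eps_into:
  assumes "q' \<in> states s"
  shows "eps D \<gamma> q q' \<longleftrightarrow> eps s \<gamma> q q'"
proof
  assume "eps D \<gamma> q q'"
  then show "eps s \<gamma> q q'"
    unfolding eps_def using assms
    by (induction rule: rtranclp_induct)
      (auto simp: trans_into dest: trans_rel_states[OF irmia] intro: rtranclp.rtrancl_into_rtrancl)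
next
  assume "eps s \<gamma> q q'"
  then show "eps D \<gamma> q q'"
    unfolding eps_def
    by (rule rtranclp_mono[THEN predicate2D, rotated])
      (use trans_into trans_rel_states(2)[OF irmia] in blast)
qed

text \<open>Underspecified transitions carry inputs, so a \<open>Tau\<close> step cannot leave the
  original states.\<close>

lemma eps_from: "eps D \<gamma> q q' \<Longrightarrow> q \<in> states s \<Longrightarrow> q' \<in> states s"
  unfolding eps_def
  by (induction rule: rtranclp_induct)
    (auto simp: trans_from underspecified_def dest: trans_rel_states[OF irmia])

lemma eps_source:
  assumes "eps s \<gamma> q q'" "q' \<in> states s"
  shows "q \<in> states s"
  using assms unfolding eps_def
  by (induction rule: converse_rtranclp_induct) (auto dest: trans_rel_states[OF irmia])

lemma output_step:
  assumes "q \<in> states s" "a \<in> outputs s"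
  shows "(q, Act a, q') \<in> trans_rel D \<gamma> \<longleftrightarrow> (q, Act a, q') \<in> trans_rel s \<gamma>"
  using assms disjoint by (auto simp: trans_from underspecified_def)

text \<open>Only the run up to and including the output matters: its \<open>Tau\<close> steps stay
  among the original states, where no output was added.\<close>

lemma weak_output:
  assumes "q \<in> states s" "a \<in> outputs s"
  shows "(\<exists>q'. weak_act D \<gamma> q a q') \<longleftrightarrow> (\<exists>q'. weak_act s \<gamma> q a q')"
proof
  assume "\<exists>q'. weak_act D \<gamma> q a q'"
  then obtain r r' where r: "eps D \<gamma> q r" "(r, Act a, r') \<in> trans_rel D \<gamma>"
    by (auto simp: weak_act_def)
  then have "r \<in> states s"
    using assms eps_from by blast
  with r assms show "\<exists>q'. weak_act s \<gamma> q a q'"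
    unfolding weak_act_def by (metis eps_into output_step eps_refl)
next
  assume "\<exists>q'. weak_act s \<gamma> q a q'"
  then obtain r r' where r: "eps s \<gamma> q r" "(r, Act a, r') \<in> trans_rel s \<gamma>"
    by (auto simp: weak_act_def)
  then have "r \<in> states s"
    using trans_rel_states[OF irmia] by blast
  with r assms show "\<exists>q'. weak_act D \<gamma> q a q'"
    unfolding weak_act_def by (metis eps_into output_step eps_refl)
qed

lemma quiescent_D: "q \<in> states s \<Longrightarrow> quiescent D \<gamma> q \<longleftrightarrow> quiescent s \<gamma> q"
  using weak_output by (simp add: quiescent_iff disjoint) blast

text \<open>Failure looks at the transitions into \<open>q\<close>, and none into an original state
  is added.\<close>

lemma failing_D: "q \<in> states s \<Longrightarrow> failing D \<gamma> q \<longleftrightarrow> failing s \<gamma> q"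
  using trans_into[where \<gamma> = May] trans_into[where \<gamma> = Must] by (cases \<gamma>) auto

lemma Out_D: "q \<in> states s \<Longrightarrow> Out D \<gamma> q = Out s \<gamma> q"
  by (auto simp: Out_def quiescent_D failing_D enabled_def output_step)

lemma obs_step_into:
  "q' \<in> states s \<Longrightarrow> obs_step D \<gamma> q x q' \<longleftrightarrow> obs_step s \<gamma> q x q'"
  by (cases x) (auto simp: trans_into quiescent_D failing_D)

lemma obs_step_source:
  "obs_step s \<gamma> q x q' \<Longrightarrow> q' \<in> states s \<Longrightarrow> q \<in> states s"
  by (cases x) (auto dest: trans_rel_states[OF irmia])

lemma weak_obs_source:
  "weak_obs s \<gamma> q x q' \<Longrightarrow> q' \<in> states s \<Longrightarrow> q \<in> states s"
  unfolding weak_obs_def by (meson eps_source obs_step_source)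

lemma weak_obs_into:
  assumes "q' \<in> states s"
  shows "weak_obs D \<gamma> q x q' \<longleftrightarrow> weak_obs s \<gamma> q x q'"
  unfolding weak_obs_def
  by (meson assms eps_into eps_source obs_step_into obs_step_source)

lemma weak_trace_source:
  "weak_trace s \<gamma> q \<sigma> q' \<Longrightarrow> q' \<in> states s \<Longrightarrow> q \<in> states s"
  by (induction \<sigma> arbitrary: q) (auto intro: eps_source weak_obs_source)

text \<open>The induction runs over the trace with the target fixed; that the intermediate states
  are original follows backwards from \<open>q'\<close>.\<close>

lemma weak_trace_into:
  "q' \<in> states s \<Longrightarrow> weak_trace D \<gamma> q \<sigma> q' \<longleftrightarrow> weak_trace s \<gamma> q \<sigma> q'"
proof (induction \<sigma> arbitrary: q)
  case Nil
  then show ?case by (simp add: eps_into)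
next
  case (Cons x \<sigma>)
  then show ?case
    by (simp add: Cons.IH) (metis weak_obs_into weak_trace_source)
qed

lemma after_D: "after D \<gamma> \<sigma> \<inter> states s = after s \<gamma> \<sigma>"
proof -
  have "q \<in> states s" if "weak_trace s \<gamma> (initial s) \<sigma> q" for q
    using trans_rel_states(2)[OF irmia] that initial_in by (rule weak_trace_target)
  then show ?thesis
    using weak_trace_into by (auto simp: after_def)
qed

lemma after_D_states:
  assumes "q \<in> after D \<gamma> \<sigma>"
  shows "q \<in> states s \<union> {c, w}"
proof (rule weak_trace_target)
  show "p' \<in> states s \<union> {c, w}" if "(p, l, p') \<in> trans_rel D \<gamma>" for p l p'
    using that trans_rel_states(2)[OF irmia, where \<gamma> = \<gamma>]
    by (cases \<gamma>) (auto simp: demonic_completion_def underspecified_def)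
  show "weak_trace D \<gamma> (initial s) \<sigma> q"
    using assms by (simp add: after_def)
qed (simp add: initial_in)

section \<open>Observations and traces of the chaotic states \<open>c\<close> and
  \<open>w\<close>\<close>

lemma chaos_eps_must:
  assumes "eps D Must q q'" "q \<in> {c, w}"
  shows "q' \<in> {c, w}"
  using assms unfolding eps_def
  by (induction rule: rtranclp_induct)
    (auto simp: demonic_completion_def underspecified_def c_fresh w_fresh
      dest: trans_rel_states[OF irmia, where \<gamma> = Must, simplified])

lemma chaos_no_must_output:
  "q \<in> {c, w} \<Longrightarrow> a \<in> outputs s \<Longrightarrow> (q, Act a, q') \<notin> must D"
  using disjoint c_fresh w_fresh
  by (auto simp: demonic_completion_def underspecified_def
      dest: trans_rel_states[OF irmia, where \<gamma> = Must, simplified])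

text \<open>May-quiescence forbids weak must-outputs: must-\<open>Tau\<close> steps stay within
  \<open>c\<close> and \<open>w\<close>, and neither has a must-output.\<close>

lemma chaos_may_quiescent: "q \<in> {c, w} \<Longrightarrow> quiescent D May q"
  using chaos_eps_must chaos_no_must_output fail_state_in c_fresh w_fresh
  unfolding quiescent_iff[of D, simplified, OF disjoint] weak_act_def
  by (metis dual.simps(2) insert_iff singletonD trans_rel.simps(1))

lemma chaos_may_trans:
  "(c, Tau, w) \<in> may D"
  "a \<in> inputs s \<union> outputs s \<Longrightarrow> (w, Act a, c) \<in> may D"
  by (auto simp: demonic_completion_def)

lemma chaos_eps_may: "eps D May c w"
  by (rule eps_step) (simp add: chaos_may_trans)

text \<open>The witness is an input from \<open>w\<close> to \<open>c\<close>, which is a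
  may-transition only: the must-transitions of \<open>w\<close> are loops.\<close>

lemma chaos_may_failing:
  assumes "inputs s \<noteq> {}"
  shows "failing D May c"
proof -
  obtain a where a: "a \<in> inputs s" using assms by auto
  have "(w, Act a, c) \<notin> must s"
    using trans_rel_states(2)[OF irmia, of w "Act a" c Must] c_fresh by auto
  then have "(w, Act a, c) \<notin> must D"
    using c_neq_w w_fresh by (simp add: demonic_completion_def underspecified_def)
  moreover have "(w, Act a, c) \<in> may D"
    using a by (simp add: chaos_may_trans)
  ultimately show ?thesis
    using a by (metis D_simps(1) failing.simps(1))
qed

text \<open>\<open>c\<close> contributes \<open>Delta\<close> and \<open>Phi\<close>, while
  \<open>w\<close> contributes the outputs.\<close>

lemma chaos_Out_may:
  assumes "inputs s \<noteq> {}"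
  shows "Vis ` outputs s \<union> {Delta, Phi} \<subseteq> Out D May c \<union> Out D May w"
proof -
  have "Delta \<in> Out D May c"
    using chaos_may_quiescent[of c] by (simp add: Out_def)
  moreover have "Phi \<in> Out D May c"
    using chaos_may_failing[OF assms] by (simp add: Out_def del: failing.simps)
  moreover have "Vis a \<in> Out D May w" if "a \<in> outputs s" for a
    using chaos_may_trans(2)[of a] that by (auto simp: Out_def enabled_def)
  ultimately show ?thesis by blast
qed

lemma chaos_Out_must:
  assumes "outputs s \<noteq> {}" "q \<in> {c, w}"
  shows "Out D Must q = {}"
proof -
  obtain a where a: "a \<in> outputs s" using assms by auto
  \<comment> \<open>The output is performed at \<open>w\<close>, which \<open>c\<close> reaches by
    \<open>Tau\<close>. Must-quiescence refers to may-transitions, so this output refutes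
    it.\<close>
  have "weak_act D May q a c"
    using assms(2) a chaos_eps_may chaos_may_trans(2)[of a] eps_refl[of D May]
    by (auto simp: weak_act_def)
  then have "\<not> quiescent D Must q"
    using a by (auto simp: quiescent_iff disjoint)
  then show ?thesis
    using assms chaos_no_must_output fail_state_in c_fresh w_fresh
    by (auto simp: Out_def enabled_def)
qed

text \<open>A visible action is performed through \<open>w\<close> and leads back to
  \<open>c\<close>; \<open>Delta\<close> and \<open>Phi\<close> loop at \<open>c\<close>, the latter
  because some input exists.\<close>

lemma chaos_trace:
  assumes "inputs s \<noteq> {}" "\<sigma> \<in> lists (observations s)"
  shows "weak_trace D May c \<sigma> c"
proof -
  have "weak_obs D May c x c" if "x \<in> observations s" for x
  proof (cases x)
    case (Vis a)
    with that have "a \<in> inputs s \<union> outputs s"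
      by (auto simp: observations_def)
    then have "(w, Act a, c) \<in> may D"
      by (rule chaos_may_trans)
    with Vis chaos_eps_may eps_refl[of D May c] show ?thesis
      unfolding weak_obs_def by fastforce
  next
    case Delta
    with chaos_may_quiescent[of c] eps_refl[of D May c] show ?thesis
      unfolding weak_obs_def by fastforce
  next
    case Phi
    with chaos_may_failing[OF assms(1)] eps_refl[of D May c] show ?thesis
      unfolding weak_obs_def by (metis obs_step.simps(3))
  qed
  then show ?thesis
    using assms(2) by (induction \<sigma>) (auto simp: eps_refl)
qed

section \<open>Traces leaving the original states, and the two inclusions\<close>

lemma escape:
  assumes "weak_trace D May p \<sigma> q" "p \<in> states s" "q \<notin> states s" "\<sigma> \<in> lists (observations s)"
  shows "inputs s \<noteq> {} \<and> weak_trace D May p \<sigma> c"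
  using assms
proof (induction \<sigma> arbitrary: p)
  case Nil
  then show ?case using eps_from by auto
next
  case (Cons x \<sigma>)
  then obtain q1 where q1: "weak_obs D May p x q1" "weak_trace D May q1 \<sigma> q"
    by auto
  show ?case
  proof (cases "q1 \<in> states s")
    case True
    with Cons q1 show ?thesis by auto
  next
    case False
    from q1(1) obtain r r' where r: "eps D May p r" "obs_step D May r x r'" "eps D May r' q1"
      by (auto simp: weak_obs_def)
    from r(1) have rs: "r \<in> states s" using Cons.prems eps_from by blast
    from r(3) False have r's: "r' \<notin> states s" using eps_from by blast
    \<comment> \<open>\<open>Delta\<close> and \<open>Phi\<close> do not change the state, so the
      observation that leaves the original states is visible.\<close>
    obtain a where a: "x = Vis a" "(r, Act a, r') \<in> trans_rel D May"
      using r(2) rs r's by (cases x) auto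
    with rs r's have "(r, Act a, r') \<in> underspecified s c"
      using trans_from trans_rel_states[OF irmia] by metis
    then have "r' = c" "inputs s \<noteq> {}"
      by (auto simp: underspecified_def)
    moreover from this r have "weak_obs D May p x c"
      unfolding weak_obs_def using eps_refl by metis
    \<comment> \<open>The exit leads to \<open>c\<close>, where the rest of the trace can be
      performed as a loop; the input on the exit shows that \<open>inputs s\<close> is
      nonempty.\<close>
    ultimately show ?thesis
      using chaos_trace Cons.prems by auto
  qed
qed

text \<open>Either all runs of the trace stay among the original states and nothing changes, or one
  escapes and then both \<open>c\<close> and \<open>w\<close> are reached, which together allow
  every observation in \<open>Out\<close>.\<close>

lemma Out_may_D:
  assumes "\<sigma> \<in> Straces D May"
  shows "\<sigma> \<in> Straces s May \<and> Out_set s May (after s May \<sigma>) \<subseteq> Out_set D May (after D May \<sigma>)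
    \<or> Vis ` outputs s \<union> {Delta, Phi} \<subseteq> Out_set D May (after D May \<sigma>)"
proof (cases "after D May \<sigma> \<subseteq> states s")
  case True
  then have "after D May \<sigma> = after s May \<sigma>"
    using after_D by blast
  moreover from this have "Out_set D May (after D May \<sigma>) = Out_set s May (after s May \<sigma>)"
    unfolding Out_set_def using True Out_D by (intro SUP_cong) auto
  ultimately show ?thesis
    using assms by (auto simp: Straces_def after_def)
next
  case False
  then have "inputs s \<noteq> {}" "weak_trace D May (initial s) \<sigma> c"
    using escape[OF _ initial_in] assms by (auto simp: after_def Straces_def)
  moreover from this have "weak_trace D May (initial s) \<sigma> w"
    using chaos_eps_may weak_trace_eps by metis
  ultimately have "{c, w} \<subseteq> after D May \<sigma>" "inputs s \<noteq> {}"
    by (auto simp: after_def)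
  then show ?thesis
    using chaos_Out_may unfolding Out_set_def by blast
qed

lemma Out_must_D:
  assumes "outputs s \<noteq> {}"
  shows "Out_set D Must (after D May \<sigma>) \<subseteq> Out_set s Must (after s May \<sigma>)"
proof -
  have "Out D Must q \<subseteq> Out_set s Must (after s May \<sigma>)" if "q \<in> after D May \<sigma>" for q
  proof (cases "q \<in> states s")
    case True
    with that show ?thesis
      using after_D Out_D by (auto simp: Out_set_def)
  next
    case False
    then have "q \<in> {c, w}"
      using after_D_states[OF that] by simp
    then show ?thesis using chaos_Out_must[OF assms] by simp
  qed
  then show ?thesis by (auto simp: Out_set_def)
qed

end

theorem theorem4:
  fixes i :: "('p, 'a) irmia" and s :: "('q, 'a) irmia" and q\<^sub>\<chi> q\<^sub>\<Omega> :: 'q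
  assumes "is_irmia i" and "is_irmia s"
    and "inputs i = inputs s" and "outputs i = outputs s"
    and "outputs s \<noteq> {}"
    and "weak_input_enabled i Must"
    and "\<forall>q\<in>states s. enabled s May q Tau \<longrightarrow> enabled s Must q Tau"
    and "q\<^sub>\<chi> \<notin> states s" and "q\<^sub>\<Omega> \<notin> states s" and "q\<^sub>\<chi> \<noteq> q\<^sub>\<Omega>"
    and "modal_irioco i s"
  shows "modal_irioco i (demonic_completion s q\<^sub>\<chi> q\<^sub>\<Omega>)"
proof -
  interpret completion s q\<^sub>\<chi> q\<^sub>\<Omega>
    using assms by unfold_locales
  have "Out_set i May (after i May \<sigma>) \<subseteq> Out_set D May (after D May \<sigma>)"
    if "\<sigma> \<in> Straces D May" for \<sigma>
  proof -
    \<comment> \<open>This bound settles the case in which the completion allows everything.\<close>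
    have "Out_set i May (after i May \<sigma>) \<subseteq> Vis ` outputs s \<union> {Delta, Phi}"
      using Out_subset[of i May] assms(4) by (simp add: Out_set_def UN_least)
    moreover have "Out_set i May (after i May \<sigma>) \<subseteq> Out_set s May (after s May \<sigma>)"
      if "\<sigma> \<in> Straces s May"
      using assms(11) that by (simp add: modal_irioco_def)
    ultimately show ?thesis
      using Out_may_D[OF that] by (meson order_trans)
  qed
  moreover have "Out_set D Must (after D May \<sigma>) \<subseteq> Out_set i Must (after i May \<sigma>)"
    if "\<sigma> \<in> Straces i May" for \<sigma>
    using assms(11) that
    by (intro order_trans[OF Out_must_D[OF assms(5)]]) (simp add: modal_irioco_def)
  ultimately show ?thesis
    using assms(11) by (simp add: modal_irioco_def)
qed

end
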